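(* Consider the biobjective integer program "$\min$" $\{z(x)=(z_1(x),z_2(x))^T : x\in\mathcal{X}\subseteq\mathbb{Z}^n\}$ with integer-valued objectives $z_1,z_2$. Let $d\in\mathbb{R}^2_+\setminus\{0\}$ (i.e. $d\ge 0$ componentwise, $d\neq 0$) and $0<\epsilon<1$. Then Algorithm 1 (described in the context) solves $$3N+C-3C_2-E-1$$ mixed integer programs, where $N$ is the number of nondominated points, $C$ is the number of cases where $y^b=n^b$, $C_2$ is the number of sub-cases (of these) in which two nondominated points are found, and $E$ is the number of boxes eliminated using the elimination rule.
   Context: Problem. $\mathcal{X}\subseteq\mathbb{Z}^n$ is the feasible set, $z_1,z_2:\mathcal{X}\to\mathbb{Z}$ are integer-valued, and $\mathcal{Z}=\{z(x):x\in\mathcal{X}\}$. It is implicitly assumed that $\mathcal{X}\ne\emptyset$ and that the two lexicographic problems below have optimal solutions. For vectors in $\mathbb{R}^2$, $\le$ is componentwise. A point $z(x)\in\mathcal{Z}$ is nondominated if there is no $x'\in\mathcal{X}$ with $z(x')\le z(x)$ and $z(x')\ne z(x)$. $\text{lexmin}\{z_i(x),z_j(x): x\in\mathcal{X}\}$ means: first solve $\min\{z_i(x):x\in\mathcal{X}\}$ with optimal solution $x'$, then solve $\min\{z_j(x):x\in\mathcal{X},\ z_i(x)=z_i(x')\}$. Thus each lexmin counts as two integer programs. A box is given by three points $s,p,t\in\mathbb{R}^2$ and is denoted $b(s,p,t)$ (as a set it is $\{y\in\mathbb{R}^2: s_1\le y_1\le p_1,\ s_2\le y_2\le t_2\}$).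 For a box $b=b(s^b,p^b,t^b)$, problem $R(b,d)$ is $$\min\{\alpha : x\in\mathcal{X},\ \alpha\in\mathbb{R},\ z(x)\le s^b+\alpha d,\ z_1(x)\le p_1^b-\epsilon,\ z_2(x)\le t_2^b-\epsilon\}.$$ Problem $P_1(x^b)$ is $\min\{z_2(x):x\in\mathcal{X},\ z_1(x)=z_1(x^b)\}$; problem $P_2(x^b)$ is $\min\{z_1(x):x\in\mathcal{X},\ z_2(x)=z_2(x^b)\}$. Algorithm 1. Fix the direction $d$ and $0<\epsilon<1$. Initialization: let $t^0$ be the objective vector of a solution of $\text{lexmin}\{z_1(x),z_2(x):x\in\mathcal{X}\}$ and $p^0$ that of $\text{lexmin}\{z_2(x),z_1(x):x\in\mathcal{X}\}$. Set the output list $\mathcal{N}=\{t^0,p^0\}$, $s^0=(t^0_1,p^0_2)^T$, $\mathcal{B}=\{b(s^0,p^0,t^0)\}$. Main loop: while $\mathcal{B}\neq\emptyset$, pick a box $b=b(s^b,p^b,t^b)\in\mathcal{B}$ and solve $R(b,d)$. If $R(b,d)$ is feasible, let $(\alpha^b,x^b)$ be an optimal solution and do the following. (1) Set $y^b=s^b+\alpha^b d$ and $n^b=z(x^b)$. (2) If $y^b_1=n^b_1$, solve $P_1(x^b)$, let $x^1$ be an optimal solution and set $n^1=z(x^1)$; otherwise set $n^1=n^b$. (3) If $y^b_2=n^b_2$, solve $P_2(x^b)$, let $x^2$ be an optimal solution and set $n^2=z(x^2)$; otherwise set $n^2=n^b$. (4) If $n^1_2<n^b_2$, add $n^1$ to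 $\mathcal{N}$. If $n^2_1<n^b_1$, add $n^2$ to $\mathcal{N}$. If $n^1_2\ge n^b_2$ and $n^2_1\ge n^b_1$, add $n^b$ to $\mathcal{N}$. (5) Set $s^1=(n^1_1,p^b_2)^T$ and $s^2=(t^b_1,n^2_2)^T$. (6) (Elimination rule.) If $p^b_1-s^1_1>1$ and $n^1_2-s^1_2>1$, add the box $b(s^1,p^b,n^1)$ to $\mathcal{B}$; otherwise this box is eliminated. If $n^2_1-s^2_1>1$ and $t^b_2-s^2_2>1$, add the box $b(s^2,n^2,t^b)$ to $\mathcal{B}$; otherwise this box is eliminated. In all cases (feasible or not), finally remove $b(s^b,p^b,t^b)$ from $\mathcal{B}$. When $\mathcal{B}$ is empty, return $\mathcal{N}$. Counting: the programs counted are the four problems of the two lexmin solves, every $R(b,d)$ solved (feasible or infeasible), and every $P_1(x^b)$ and $P_2(x^b)$ solved. The numbers $C$, $C_2$, $E$ refer to the given run of the algorithm (they may depend on how ties among optimal solutions are broken). "Two nondominated points are found" in an iteration means that both $n^1$ and $n^2$ are added to $\mathcal{N}$ in step (4).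
   Formalization: The formal statement also assumes that N is not 1, and that both components of d are positive if N > 2; otherwise the first R(b,d) is infeasible, so the algorithm solves exactly 5 programs and the formula, giving 3N-1, fails. *)

theory Defs
  imports "HOL-Analysis.Analysis"
begin

text \<open>
  A biobjective integer program is given by a feasible set \<open>X\<close> of integer vectors and an objective
  map \<open>z\<close>; only the values of \<open>z\<close> on \<open>X\<close> matter. The order on \<open>real ^ 2\<close> and \<open>int ^ 2\<close> is
  the componentwise one.
\<close>

definition objective :: "(int ^ 'n \<Rightarrow> int ^ 2) \<Rightarrow> int ^ 'n \<Rightarrow> real ^ 2" where
  "objective z x = (\<chi> i. real_of_int (z x $ i))"

definition nondominated :: "(int ^ 'n) set \<Rightarrow> (int ^ 'n \<Rightarrow> int ^ 2) \<Rightarrow> (real ^ 2) set" where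
  "nondominated X z =
     {y \<in> objective z ` X. \<not> (\<exists>x'\<in>X. objective z x' \<le> y \<and> objective z x' \<noteq> y)}"

definition lexmin :: "(int ^ 'n) set \<Rightarrow> (int ^ 'n \<Rightarrow> int ^ 2) \<Rightarrow> 2 \<Rightarrow> 2 \<Rightarrow> int ^ 'n \<Rightarrow> bool" where
  "lexmin X z i j x \<longleftrightarrow>
     (\<exists>x'. is_arg_min (\<lambda>u. z u $ i) (\<lambda>u. u \<in> X) x' \<and>
           is_arg_min (\<lambda>u. z u $ j) (\<lambda>u. u \<in> X \<and> z u $ i = z x' $ i) x)"

text \<open>\<open>Box s p t\<close> is kept as the triple of its defining points.\<close>

datatype box = Box (box_s: "real ^ 2") (box_p: "real ^ 2") (box_t: "real ^ 2")

text \<open>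
  Feasible set of \<open>R(b,d)\<close>, as pairs \<open>(\<alpha>, x)\<close>; the objective is \<open>fst\<close>. If \<open>d\<close> has a zero
  component, it is empty for the initial box: \<open>d\<^sub>i = 0\<close> forces \<open>z\<^sub>i(x) \<le> s\<^sub>i\<close>, so that
  \<open>z\<^sub>i(x)\<close> is minimal on \<open>X\<close>, while the other objective is required to be below its
  lexicographic optimum.
\<close>

definition R_feasible ::
  "(int ^ 'n) set \<Rightarrow> (int ^ 'n \<Rightarrow> int ^ 2) \<Rightarrow> real \<Rightarrow> real ^ 2 \<Rightarrow> box \<Rightarrow> (real \<times> (int ^ 'n)) set" where
  "R_feasible X z \<epsilon> d b =
     {(\<alpha>, x). x \<in> X \<and> objective z x \<le> box_s b + \<alpha> *\<^sub>R d \<and>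
        objective z x $ 1 \<le> box_p b $ 1 - \<epsilon> \<and> objective z x $ 2 \<le> box_t b $ 2 - \<epsilon>}"

definition R_optimal ::
  "(int ^ 'n) set \<Rightarrow> (int ^ 'n \<Rightarrow> int ^ 2) \<Rightarrow> real \<Rightarrow> real ^ 2 \<Rightarrow> box \<Rightarrow> real \<Rightarrow> int ^ 'n \<Rightarrow> bool" where
  "R_optimal X z \<epsilon> d b \<alpha> x \<longleftrightarrow> is_arg_min fst (\<lambda>u. u \<in> R_feasible X z \<epsilon> d b) (\<alpha>, x)"

definition P1_optimal ::
  "(int ^ 'n) set \<Rightarrow> (int ^ 'n \<Rightarrow> int ^ 2) \<Rightarrow> int ^ 'n \<Rightarrow> int ^ 'n \<Rightarrow> bool" where
  "P1_optimal X z xb x \<longleftrightarrow> is_arg_min (\<lambda>u. z u $ 2) (\<lambda>u. u \<in> X \<and> z u $ 1 = z xb $ 1) x"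

definition P2_optimal ::
  "(int ^ 'n) set \<Rightarrow> (int ^ 'n \<Rightarrow> int ^ 2) \<Rightarrow> int ^ 'n \<Rightarrow> int ^ 'n \<Rightarrow> bool" where
  "P2_optimal X z xb x \<longleftrightarrow> is_arg_min (\<lambda>u. z u $ 1) (\<lambda>u. u \<in> X \<and> z u $ 2 = z xb $ 2) x"

text \<open>
  State of the algorithm together with the counters: \<open>programs\<close> is the number of programs solved so
  far, \<open>cases_eq\<close> is \<open>C\<close>, \<open>cases_two\<close> is \<open>C\<^sub>2\<close> and \<open>eliminated\<close> is \<open>E\<close>.
\<close>

record alg_state =
  boxes :: "box set"
  found :: "(real ^ 2) set"
  programs :: nat
  cases_eq :: nat
  cases_two :: nat
  eliminated :: nat

text \<open>The initial value 4 of \<open>programs\<close> accounts for two integer programs per \<open>lexmin\<close>.\<close>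

definition initial :: "(int ^ 'n) set \<Rightarrow> (int ^ 'n \<Rightarrow> int ^ 2) \<Rightarrow> alg_state \<Rightarrow> bool" where
  "initial X z \<sigma> \<longleftrightarrow>
     (\<exists>xt xp t0 p0. lexmin X z 1 2 xt \<and> t0 = objective z xt \<and>
        lexmin X z 2 1 xp \<and> p0 = objective z xp \<and>
        \<sigma> = \<lparr>boxes = {Box (vector [t0 $ 1, p0 $ 2]) p0 t0}, found = {t0, p0},
             programs = 4, cases_eq = 0, cases_two = 0, eliminated = 0\<rparr>)"

text \<open>
  One iteration of the main loop. The relation is nondeterministic in the choice of the box and of
  the optimal solutions.
\<close>

inductive step ::
  "(int ^ 'n) set \<Rightarrow> (int ^ 'n \<Rightarrow> int ^ 2) \<Rightarrow> real \<Rightarrow> real ^ 2 \<Rightarrow> alg_state \<Rightarrow> alg_state \<Rightarrow> bool"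
  for X z \<epsilon> d where
  infeasible:
    "\<lbrakk>b \<in> boxes \<sigma>; R_feasible X z \<epsilon> d b = {}\<rbrakk>
     \<Longrightarrow> step X z \<epsilon> d \<sigma> (\<sigma>\<lparr>boxes := boxes \<sigma> - {b}, programs := programs \<sigma> + 1\<rparr>)"
| feasible:
    "\<lbrakk>b \<in> boxes \<sigma>; b = Box s p t; R_optimal X z \<epsilon> d b \<alpha> x;
      y = s + \<alpha> *\<^sub>R d; n = objective z x;
      if y $ 1 = n $ 1 then \<exists>x1. P1_optimal X z x x1 \<and> n1 = objective z x1 else n1 = n;
      if y $ 2 = n $ 2 then \<exists>x2. P2_optimal X z x x2 \<and> n2 = objective z x2 else n2 = n;
      new_points = (if n1 $ 2 < n $ 2 then {n1} else {}) \<union> (if n2 $ 1 < n $ 1 then {n2} else {}) \<union>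
        (if n1 $ 2 \<ge> n $ 2 \<and> n2 $ 1 \<ge> n $ 1 then {n} else {});
      s1 = vector [n1 $ 1, p $ 2]; s2 = vector [t $ 1, n2 $ 2];
      keep1 \<longleftrightarrow> p $ 1 - s1 $ 1 > 1 \<and> n1 $ 2 - s1 $ 2 > 1;
      keep2 \<longleftrightarrow> n2 $ 1 - s2 $ 1 > 1 \<and> t $ 2 - s2 $ 2 > 1;
      new_boxes = (if keep1 then {Box s1 p n1} else {}) \<union> (if keep2 then {Box s2 n2 t} else {})\<rbrakk>
     \<Longrightarrow> step X z \<epsilon> d \<sigma>
          \<lparr>boxes = (boxes \<sigma> \<union> new_boxes) - {b},
           found = found \<sigma> \<union> new_points,
           programs = programs \<sigma> + 1 + of_bool (y $ 1 = n $ 1) + of_bool (y $ 2 = n $ 2),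
           cases_eq = cases_eq \<sigma> + of_bool (y = n),
           cases_two = cases_two \<sigma> + of_bool (y = n \<and> n1 $ 2 < n $ 2 \<and> n2 $ 1 < n $ 1),
           eliminated = eliminated \<sigma> + of_bool (\<not> keep1) + of_bool (\<not> keep2)\<rparr>"

end

theory Submission imports Defs begin

text \<open>
  Every box \<open>b(s,p,t)\<close> that is kept satisfies \<open>s = (t\<^sub>1, p\<^sub>2)\<close>, and every feasible image \<open>y\<close> with
  \<open>y\<^sub>1 < p\<^sub>1\<close>, \<open>y\<^sub>2 < t\<^sub>2\<close> lies strictly above \<open>s\<close>; by integrality an eliminated box therefore contains
  no image. The points \<open>p\<close>, \<open>t\<close> themselves may be dominated. If \<open>R(b,d)\<close> is feasible, no image in
  the box is strictly below \<open>y\<^sup>b\<close> in both components, so \<open>n\<^sup>b\<close> and \<open>y\<^sup>b\<close> agree in some component, the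
  added points are new and nondominated, and the undiscovered nondominated points of the box are
  those of the two new boxes. With \<open>F\<close> feasible and \<open>I\<close> infeasible subproblems this gives
  \<open>N = 2 + F + C\<^sub>2\<close>, \<open>1 + 2F - E = F + I\<close> and \<open>4 + 2F + I + C\<close> programs; eliminating \<open>F\<close> and \<open>I\<close>
  yields the claim. A feasible subproblem exhibits a third nondominated point, so that \<open>d\<close> is
  then strictly positive.
\<close>

section \<open>Integer minima, images and boxes\<close>

lemma ex_is_arg_min_int:
  fixes f :: "'a \<Rightarrow> int"
  assumes "P a" and bound: "\<And>x. P x \<Longrightarrow> c \<le> f x"
  shows "\<exists>x. is_arg_min f P x"
proof -
  obtain x where "P x" and le: "\<And>u. P u \<Longrightarrow> nat (f x - c) \<le> nat (f u - c)"
    using ex_has_least_nat[of P a "\<lambda>u. nat (f u - c)"] assms(1) by blast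
  then have "f x \<le> f u" if "P u" for u
    using bound[OF that] bound[OF \<open>P x\<close>] le[OF that] by linarith
  with \<open>P x\<close> show ?thesis
    by (auto simp: is_arg_min_linorder)
qed

lemma vec2_eqI: "a $ 1 = b $ 1 \<Longrightarrow> a $ 2 = b $ 2 \<Longrightarrow> a = b" for a b :: "'a ^ 2"
  by (simp add: vec_eq_iff forall_2)

lemma vec2_le_iff: "a \<le> b \<longleftrightarrow> a $ 1 \<le> b $ 1 \<and> a $ 2 \<le> b $ 2" for a b :: "real ^ 2"
  by (simp add: less_eq_vec_def forall_2)

lemma objective_nth [simp]: "objective z x $ i = real_of_int (z x $ i)"
  by (simp add: objective_def)

lemma nondominated_iff:
  "y \<in> nondominated X z \<longleftrightarrow> y \<in> objective z ` X \<and>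
     (\<forall>q\<in>objective z ` X. q $ 1 \<le> y $ 1 \<longrightarrow> q $ 2 \<le> y $ 2 \<longrightarrow> q = y)"
  unfolding nondominated_def by (auto simp: vec2_le_iff)

lemma image_add_one_le:
  assumes "q \<in> objective z ` X" "r \<in> objective z ` X" "q $ i < r $ i"
  shows "q $ i + 1 \<le> r $ i"
  using assms by auto

lemma finite_images_in_rectangle:
  "finite {q \<in> objective z ` X. a \<le> q $ 1 \<and> q $ 1 \<le> b \<and> c \<le> q $ 2 \<and> q $ 2 \<le> e}"
    (is "finite ?S")
proof (rule finite_subset)
  let ?f = "\<lambda>(i::int, j::int). vector [real_of_int i, real_of_int j] :: real ^ 2"
  show "?S \<subseteq> ?f ` ({\<lfloor>a\<rfloor>..\<lceil>b\<rceil>} \<times> {\<lfloor>c\<rfloor>..\<lceil>e\<rceil>})"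
  proof
    fix q assume "q \<in> ?S"
    then obtain x where q: "q = objective z x"
      and "a \<le> real_of_int (z x $ 1)" "real_of_int (z x $ 1) \<le> b"
      and "c \<le> real_of_int (z x $ 2)" "real_of_int (z x $ 2) \<le> e"
      by auto
    then have "(z x $ 1, z x $ 2) \<in> {\<lfloor>a\<rfloor>..\<lceil>b\<rceil>} \<times> {\<lfloor>c\<rfloor>..\<lceil>e\<rceil>}"
      by (auto, linarith+)
    moreover have "q = ?f (z x $ 1, z x $ 2)"
      by (simp add: q vec_eq_iff forall_2 vector_2)
    ultimately show "q \<in> ?f ` ({\<lfloor>a\<rfloor>..\<lceil>b\<rceil>} \<times> {\<lfloor>c\<rfloor>..\<lceil>e\<rceil>})"
      by blast
  qed
qed simp

lemma lexmin_imageD: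
  assumes "lexmin X z i j x"
  shows "x \<in> X" and "\<And>q. q \<in> objective z ` X \<Longrightarrow> objective z x $ i \<le> q $ i"
    and "\<And>q. \<lbrakk>q \<in> objective z ` X; q $ i = objective z x $ i\<rbrakk> \<Longrightarrow> objective z x $ j \<le> q $ j"
  using assms by (force simp: lexmin_def is_arg_min_linorder)+

text \<open>Lower bounds are left out: for a good box they hold strictly by \<open>good_box\<close>.
  The strict upper bounds encode the \<open>\<epsilon>\<close>-constraints, since all values are
  integers and 0 < \<epsilon> < 1.\<close>

definition region :: "(int ^ 'n) set \<Rightarrow> (int ^ 'n \<Rightarrow> int ^ 2) \<Rightarrow> box \<Rightarrow> (real ^ 2) set" where
  "region X z b = {y \<in> objective z ` X. y $ 1 < box_p b $ 1 \<and> y $ 2 < box_t b $ 2}"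

text \<open>Being images gives \<open>p\<close> and \<open>t\<close> integer coordinates.
  Nondominance would not survive splitting, because an unprojected \<open>n\<close> may be
  dominated.\<close>

definition good_box :: "(int ^ 'n) set \<Rightarrow> (int ^ 'n \<Rightarrow> int ^ 2) \<Rightarrow> box \<Rightarrow> bool" where
  "good_box X z b \<longleftrightarrow>
     box_s b = vector [box_t b $ 1, box_p b $ 2] \<and>
     box_p b \<in> objective z ` X \<and> box_t b \<in> objective z ` X \<and> box_t b $ 1 < box_p b $ 1 \<and>
     (\<forall>y\<in>region X z b. box_t b $ 1 < y $ 1 \<and> box_p b $ 2 < y $ 2)"

text \<open>For positive \<open>d\<close> this is the least \<alpha> with
  \<open>q \<le> s + \<alpha> *\<^sub>R d\<close>, a weighted Chebyshev distance from the corner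
  \<open>s\<close>.\<close>

definition level :: "real ^ 2 \<Rightarrow> box \<Rightarrow> real ^ 2 \<Rightarrow> real" where
  "level d b q = max ((q $ 1 - box_s b $ 1) / d $ 1) ((q $ 2 - box_s b $ 2) / d $ 2)"

text \<open>With a single nondominated point, \<open>t0 = p0\<close> and five programs are solved
  while the formula yields 2; hence \<open>card_ne_one\<close>. If \<open>d\<close> has a zero
  component, the initial subproblem is infeasible even when its box contains a third nondominated
  point; hence \<open>direction_pos\<close>.\<close>

locale biobjective =
  fixes X :: "(int ^ 'n) set" and z :: "int ^ 'n \<Rightarrow> int ^ 2" and d :: "real ^ 2" and \<epsilon> :: real
  assumes ex_lexmin12: "\<exists>x. lexmin X z 1 2 x"
    and ex_lexmin21: "\<exists>x. lexmin X z 2 1 x"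
    and eps_pos: "0 < \<epsilon>" and eps_less_one: "\<epsilon> < 1"
    and card_ne_one: "card (nondominated X z) \<noteq> 1"
    and direction_pos: "card (nondominated X z) > 2 \<Longrightarrow> 0 < d $ 1 \<and> 0 < d $ 2"
begin

section \<open>Existence and finiteness of nondominated points\<close>

lemma lower_bounds:
  obtains c1 c2 where "\<And>x. x \<in> X \<Longrightarrow> c1 \<le> z x $ 1" "\<And>x. x \<in> X \<Longrightarrow> c2 \<le> z x $ 2"
proof -
  obtain u v where "lexmin X z 1 2 u" "lexmin X z 2 1 v"
    using ex_lexmin12 ex_lexmin21 by blast
  from lexmin_imageD(2)[OF this(1)] lexmin_imageD(2)[OF this(2)]
  show thesis by (intro that[of "z u $ 1" "z v $ 2"]) force+
qed

text \<open>A minimiser of the sum of both objectives among the feasible points weakly below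
  \<open>q\<close> is nondominated. It exists even for infinite \<open>X\<close>, as both objectives
  are bounded below.\<close>

lemma ex_nondominated_le:
  assumes "q \<in> objective z ` X"
  shows "\<exists>r\<in>nondominated X z. r $ 1 \<le> q $ 1 \<and> r $ 2 \<le> q $ 2"
proof -
  obtain c1 c2 where c: "\<And>x. x \<in> X \<Longrightarrow> c1 \<le> z x $ 1" "\<And>x. x \<in> X \<Longrightarrow> c2 \<le> z x $ 2"
    using lower_bounds by blast
  obtain x where x: "x \<in> X" "q = objective z x" using assms by auto
  let ?P = "\<lambda>u. u \<in> X \<and> z u $ 1 \<le> z x $ 1 \<and> z u $ 2 \<le> z x $ 2"
  have "\<exists>u. is_arg_min (\<lambda>u. z u $ 1 + z u $ 2) ?P u"
    by (rule ex_is_arg_min_int[of _ x "c1 + c2"]) (use x c in \<open>auto intro: add_mono\<close>)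
  then obtain u where u: "?P u" and min: "\<And>v. ?P v \<Longrightarrow> z u $ 1 + z u $ 2 \<le> z v $ 1 + z v $ 2"
    by (auto simp: is_arg_min_linorder)
  have "objective z u \<in> nondominated X z"
  proof (unfold nondominated_iff, intro conjI ballI impI)
    fix q assume "q \<in> objective z ` X"
      and le: "q $ 1 \<le> objective z u $ 1" "q $ 2 \<le> objective z u $ 2"
    then obtain v where v: "v \<in> X" "q = objective z v" by auto
    with le u min[of v] show "q = objective z u"
      by (intro vec2_eqI) auto
  qed (use u in auto)
  then show ?thesis using u x by force
qed

lemma lexmin_nondominated:
  assumes "lexmin X z 1 2 x \<or> lexmin X z 2 1 x"
  shows "objective z x \<in> nondominated X z"
proof (unfold nondominated_iff, intro conjI ballI impI)
  show "objective z x \<in> objective z ` X"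
    using assms lexmin_imageD(1) by blast
  fix q assume "q \<in> objective z ` X" "q $ 1 \<le> objective z x $ 1" "q $ 2 \<le> objective z x $ 2"
  with assms show "q = objective z x"
  proof (elim disjE)
    assume "lexmin X z 1 2 x"
    note x = lexmin_imageD(2,3)[OF this \<open>q \<in> objective z ` X\<close>]
    have "q $ 1 = objective z x $ 1" using x(1) \<open>q $ 1 \<le> objective z x $ 1\<close> by linarith
    then show ?thesis using x(2) \<open>q $ 2 \<le> objective z x $ 2\<close> by (intro vec2_eqI) linarith+
  next
    assume "lexmin X z 2 1 x"
    note x = lexmin_imageD(2,3)[OF this \<open>q \<in> objective z ` X\<close>]
    have "q $ 2 = objective z x $ 2" using x(1) \<open>q $ 2 \<le> objective z x $ 2\<close> by linarith
    then show ?thesis using x(2) \<open>q $ 1 \<le> objective z x $ 1\<close> by (intro vec2_eqI) linarith+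
  qed
qed

text \<open>The two lexicographic optima span a rectangle that contains every nondominated point,
  and it holds finitely many integer vectors.\<close>

lemma finite_nondominated: "finite (nondominated X z)"
proof -
  obtain u v where uv: "lexmin X z 1 2 u" "lexmin X z 2 1 v"
    using ex_lexmin12 ex_lexmin21 by blast
  note u = lexmin_imageD[OF uv(1)] and v = lexmin_imageD[OF uv(2)]
  have "nondominated X z \<subseteq> {q \<in> objective z ` X. objective z u $ 1 \<le> q $ 1 \<and>
      q $ 1 \<le> objective z v $ 1 \<and> objective z v $ 2 \<le> q $ 2 \<and> q $ 2 \<le> objective z u $ 2}"
  proof
    fix q assume "q \<in> nondominated X z"
    then have q: "q \<in> objective z ` X"
      and min: "\<And>r. r \<in> objective z ` X \<Longrightarrow> r $ 1 \<le> q $ 1 \<Longrightarrow> r $ 2 \<le> q $ 2 \<Longrightarrow> r = q"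
      by (auto simp: nondominated_iff)
    have "q $ 1 \<le> objective z v $ 1"
      using min[of "objective z v"] v(1) v(2)[OF q] by force
    moreover have "q $ 2 \<le> objective z u $ 2"
      using min[of "objective z u"] u(1) u(2)[OF q] by force
    ultimately show "q \<in> {q \<in> objective z ` X. objective z u $ 1 \<le> q $ 1 \<and>
      q $ 1 \<le> objective z v $ 1 \<and> objective z v $ 2 \<le> q $ 2 \<and> q $ 2 \<le> objective z u $ 2}"
      using q u(2)[OF q] v(2)[OF q] by blast
  qed
  then show ?thesis
    by (rule finite_subset) (rule finite_images_in_rectangle)
qed

section \<open>The subproblem R(b,d) and the projections\<close>

lemma R_feasible_imp_region:
  assumes "(\<alpha>, x) \<in> R_feasible X z \<epsilon> d b"
  shows "objective z x \<in> region X z b"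
  using assms eps_pos by (auto simp: R_feasible_def region_def)

text \<open>An image strictly below \<open>p\<close> or \<open>t\<close> in a coordinate is below by
  at least 1, hence by more than \<open>\<epsilon>\<close>. So the subproblem amounts to minimising
  \<open>level\<close> over the region.\<close>

lemma mem_R_feasible_iff:
  assumes "good_box X z b" and d: "0 < d $ 1" "0 < d $ 2"
  shows "(\<alpha>, x) \<in> R_feasible X z \<epsilon> d b \<longleftrightarrow>
    x \<in> X \<and> objective z x \<in> region X z b \<and> level d b (objective z x) \<le> \<alpha>"
proof -
  have p: "box_p b \<in> objective z ` X" and t: "box_t b \<in> objective z ` X"
    using assms(1) by (auto simp: good_box_def)
  have "objective z x $ 1 \<le> box_p b $ 1 - \<epsilon>" if "x \<in> X" "objective z x $ 1 < box_p b $ 1"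
    using image_add_one_le[OF _ p that(2)] that(1) eps_less_one by force
  moreover have "objective z x $ 2 \<le> box_t b $ 2 - \<epsilon>" if "x \<in> X" "objective z x $ 2 < box_t b $ 2"
    using image_add_one_le[OF _ t that(2)] that(1) eps_less_one by force
  moreover have "level d b (objective z x) \<le> \<alpha> \<longleftrightarrow> objective z x \<le> box_s b + \<alpha> *\<^sub>R d"
    using d by (simp add: level_def vec2_le_iff pos_divide_le_eq algebra_simps)
  ultimately show ?thesis
    using eps_pos by (auto simp: R_feasible_def region_def)
qed

lemma finite_region:
  assumes "good_box X z b"
  shows "finite (region X z b)"
proof -
  have "region X z b \<subseteq> {q \<in> objective z ` X. box_t b $ 1 \<le> q $ 1 \<and> q $ 1 \<le> box_p b $ 1 \<and>
      box_p b $ 2 \<le> q $ 2 \<and> q $ 2 \<le> box_t b $ 2}"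
    using assms by (force simp: good_box_def region_def)
  then show ?thesis
    by (rule finite_subset) (rule finite_images_in_rectangle)
qed

lemma ex_R_optimal:
  assumes good: "good_box X z b" and d: "0 < d $ 1" "0 < d $ 2" and ne: "region X z b \<noteq> {}"
  shows "\<exists>\<alpha> x. R_optimal X z \<epsilon> d b \<alpha> x"
proof -
  obtain q where q: "q \<in> region X z b" and min: "\<And>r. r \<in> region X z b \<Longrightarrow> level d b q \<le> level d b r"
    using ex_is_arg_min_if_finite[OF finite_region[OF good] ne, of "level d b"]
    by (auto simp: is_arg_min_linorder)
  obtain x where x: "x \<in> X" "q = objective z x" using q by (auto simp: region_def)
  have "R_optimal X z \<epsilon> d b (level d b q) x"
    using x q min
    by (fastforce simp: R_optimal_def is_arg_min_linorder mem_R_feasible_iff[OF good d])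
  then show ?thesis by blast
qed

lemma ex_P1_optimal: "x \<in> X \<Longrightarrow> \<exists>x1. P1_optimal X z x x1"
  unfolding P1_optimal_def
  by (rule lower_bounds) (rule ex_is_arg_min_int[of _ x], auto)

lemma ex_P2_optimal: "x \<in> X \<Longrightarrow> \<exists>x2. P2_optimal X z x x2"
  unfolding P2_optimal_def
  by (rule lower_bounds) (rule ex_is_arg_min_int[of _ x], auto)

end

section \<open>Splitting a box in a feasible iteration\<close>

locale box_split = biobjective +
  fixes b :: box and \<alpha> :: real and x :: "int ^ 'n" and y n n1 n2 :: "real ^ 2"
  assumes good: "good_box X z b" and d1_pos: "0 < d $ 1" and d2_pos: "0 < d $ 2"
    and optimal: "R_optimal X z \<epsilon> d b \<alpha> x"
    and y_def: "y = box_s b + \<alpha> *\<^sub>R d" and n_def: "n = objective z x"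
    and n1_spec: "if y $ 1 = n $ 1 then \<exists>x1. P1_optimal X z x x1 \<and> n1 = objective z x1 else n1 = n"
    and n2_spec: "if y $ 2 = n $ 2 then \<exists>x2. P2_optimal X z x x2 \<and> n2 = objective z x2 else n2 = n"
begin

lemma feasible: "(\<alpha>, x) \<in> R_feasible X z \<epsilon> d b"
  using optimal by (simp add: R_optimal_def is_arg_min_def)

lemma n_in_region: "n \<in> region X z b"
  using R_feasible_imp_region[OF feasible] by (simp add: n_def)

lemma n_le_y: "n $ 1 \<le> y $ 1" "n $ 2 \<le> y $ 2"
  using feasible by (auto simp: R_feasible_def vec2_le_iff n_def y_def)

text \<open>Such an image would be feasible with \<alpha> replaced by its smaller
  \<open>level\<close>. The minimality of \<alpha> enters the analysis of the split only
  here.\<close>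

lemma no_image_below_y:
  assumes "q \<in> region X z b" "q $ 1 < y $ 1" "q $ 2 < y $ 2"
  shows False
proof -
  obtain u where u: "u \<in> X" "q = objective z u" using assms(1) by (auto simp: region_def)
  have "level d b q < \<alpha>"
    using assms(2,3) d1_pos d2_pos by (simp add: level_def y_def pos_divide_less_eq algebra_simps)
  moreover have "(level d b q, u) \<in> R_feasible X z \<epsilon> d b"
    using u assms(1) by (simp add: mem_R_feasible_iff[OF good d1_pos d2_pos])
  ultimately show False
    using optimal by (auto simp: R_optimal_def is_arg_min_def)
qed

lemma touches: "y $ 1 = n $ 1 \<or> y $ 2 = n $ 2"
  using no_image_below_y[OF n_in_region] n_le_y by force

lemma x_feasible: "x \<in> X"
  using feasible by (simp add: R_feasible_def)

lemma n_image: "n \<in> objective z ` X"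
  using x_feasible by (simp add: n_def)

lemma n1_props:
  "n1 \<in> objective z ` X" "n1 $ 1 = n $ 1" "n1 $ 2 \<le> n $ 2"
  "y $ 1 \<noteq> n $ 1 \<Longrightarrow> n1 = n"
  "y $ 1 = n $ 1 \<Longrightarrow> q \<in> objective z ` X \<Longrightarrow> q $ 1 = n $ 1 \<Longrightarrow> n1 $ 2 \<le> q $ 2"
  using n1_spec x_feasible
  by (auto simp: P1_optimal_def is_arg_min_linorder n_def split: if_splits)

lemma n2_props:
  "n2 \<in> objective z ` X" "n2 $ 2 = n $ 2" "n2 $ 1 \<le> n $ 1"
  "y $ 2 \<noteq> n $ 2 \<Longrightarrow> n2 = n"
  "y $ 2 = n $ 2 \<Longrightarrow> q \<in> objective z ` X \<Longrightarrow> q $ 2 = n $ 2 \<Longrightarrow> n2 $ 1 \<le> q $ 1"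
  using n2_spec x_feasible
  by (auto simp: P2_optimal_def is_arg_min_linorder n_def split: if_splits)

lemma n_bounds:
  "box_t b $ 1 < n $ 1" "n $ 1 < box_p b $ 1" "box_p b $ 2 < n $ 2" "n $ 2 < box_t b $ 2"
  using n_in_region good by (auto simp: region_def good_box_def)

text \<open>Whatever dominates a point of the region is again in the region, so nondominance can be
  tested inside the box.\<close>

lemma region_down_closed:
  "r \<in> region X z b \<Longrightarrow> q \<in> objective z ` X \<Longrightarrow> q $ 1 \<le> r $ 1 \<Longrightarrow> q $ 2 \<le> r $ 2 \<Longrightarrow>
    q \<in> region X z b"
  by (auto simp: region_def)

lemma n1_in_region: "n1 \<in> region X z b"
  using region_down_closed[OF n_in_region n1_props(1)] n1_props(2,3) by simp

lemma n2_in_region: "n2 \<in> region X z b"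
  using region_down_closed[OF n_in_region n2_props(1)] n2_props(2,3) by simp

definition box1 :: box where "box1 = Box (vector [n1 $ 1, box_p b $ 2]) (box_p b) n1"

definition box2 :: box where "box2 = Box (vector [box_t b $ 1, n2 $ 2]) n2 (box_t b)"

definition new_points :: "(real ^ 2) set" where
  "new_points = (if n1 $ 2 < n $ 2 then {n1} else {}) \<union> (if n2 $ 1 < n $ 1 then {n2} else {}) \<union>
     (if n1 $ 2 \<ge> n $ 2 \<and> n2 $ 1 \<ge> n $ 1 then {n} else {})"

lemma region_box1_subset: "region X z box1 \<subseteq> region X z b"
  using n1_props(3) n_bounds by (auto simp: region_def box1_def)

lemma region_box2_subset: "region X z box2 \<subseteq> region X z b"
  using n2_props(3) n_bounds by (auto simp: region_def box2_def)

text \<open>From \<open>q $ 2 < n1 $ 2\<close> and \<open>n1 $ 2 \<le> y $ 2\<close> it follows that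
  \<open>q $ 1 \<ge> y $ 1\<close>, because \<open>q\<close> is not strictly below \<open>y\<close>.
  So \<open>q $ 1 = n $ 1\<close> is possible only if \<open>y $ 1 = n $ 1\<close>; then P1 was
  solved and \<open>n1\<close> is lowest on that vertical line.\<close>

lemma region_box1_gt:
  assumes "q \<in> region X z box1"
  shows "n1 $ 1 < q $ 1" "box_p b $ 2 < q $ 2"
proof -
  have qb: "q \<in> region X z b" using assms region_box1_subset by blast
  then show "box_p b $ 2 < q $ 2" using good by (auto simp: good_box_def)
  have q: "q \<in> objective z ` X" "q $ 2 < n1 $ 2" using assms by (auto simp: region_def box1_def)
  show "n1 $ 1 < q $ 1"
    using no_image_below_y[OF qb] q n1_props(2-4) n1_props(5)[OF _ q(1)] n_le_y
    by (cases "y $ 1 = n $ 1"; cases "q $ 1 = n $ 1") force+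
qed

lemma region_box2_gt:
  assumes "q \<in> region X z box2"
  shows "n2 $ 2 < q $ 2" "box_t b $ 1 < q $ 1"
proof -
  have qb: "q \<in> region X z b" using assms region_box2_subset by blast
  then show "box_t b $ 1 < q $ 1" using good by (auto simp: good_box_def)
  have q: "q \<in> objective z ` X" "q $ 1 < n2 $ 1" using assms by (auto simp: region_def box2_def)
  show "n2 $ 2 < q $ 2"
    using no_image_below_y[OF qb] q n2_props(2-4) n2_props(5)[OF _ q(1)] n_le_y
    by (cases "y $ 2 = n $ 2"; cases "q $ 2 = n $ 2") force+
qed

lemma good_box1: "good_box X z box1"
  using good n1_props n_bounds region_box1_gt by (auto simp: good_box_def box1_def)

lemma good_box2: "good_box X z box2"
proof -
  \<comment> \<open>P2 may have moved the first coordinate to the left, so \<open>n_bounds\<close>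
    does not give this; \<open>n2\<close> is still in the region.\<close>
  have "box_t b $ 1 < n2 $ 1"
    using n2_in_region good by (auto simp: good_box_def)
  then show ?thesis
    using good n2_props region_box2_gt by (auto simp: good_box_def box2_def)
qed

text \<open>A strict improvement means that P1 was solved, so \<open>y $ 1 = n $ 1\<close>. A point
  weakly below \<open>n1\<close> is below \<open>y\<close> in the second coordinate, so it must lie
  on the vertical line through \<open>n\<close>, where \<open>n1\<close> is lowest.\<close>

lemma n1_nondominated:
  assumes "n1 $ 2 < n $ 2"
  shows "n1 \<in> nondominated X z"
proof (unfold nondominated_iff, intro conjI ballI impI n1_props(1))
  fix q assume q: "q \<in> objective z ` X" "q $ 1 \<le> n1 $ 1" "q $ 2 \<le> n1 $ 2"
  have eq: "y $ 1 = n $ 1" using assms n1_props(4) by auto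
  have "q \<in> region X z b" using region_down_closed[OF n1_in_region q] .
  then have "q $ 1 = n $ 1"
    using no_image_below_y[of q] q assms n1_props(2) n_le_y eq by force
  then show "q = n1"
    using n1_props(5)[OF eq q(1)] n1_props(2) q(3) by (intro vec2_eqI) auto
qed

lemma n2_nondominated:
  assumes "n2 $ 1 < n $ 1"
  shows "n2 \<in> nondominated X z"
proof (unfold nondominated_iff, intro conjI ballI impI n2_props(1))
  fix q assume q: "q \<in> objective z ` X" "q $ 1 \<le> n2 $ 1" "q $ 2 \<le> n2 $ 2"
  have eq: "y $ 2 = n $ 2" using assms n2_props(4) by auto
  have "q \<in> region X z b" using region_down_closed[OF n2_in_region q] .
  then have "q $ 2 = n $ 2"
    using no_image_below_y[of q] q assms n2_props(2) n_le_y eq by force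
  then show "q = n2"
    using n2_props(5)[OF eq q(1)] n2_props(2) q(2) by (intro vec2_eqI) auto
qed

text \<open>A point weakly below \<open>n\<close> shares a coordinate with it, or it would be
  strictly below \<open>y\<close>. If \<open>y\<close> agrees with \<open>n\<close> in the shared
  coordinate, the projection that did not improve forces equality; otherwise the point is below
  \<open>y\<close> there, which bounds its other coordinate from below.\<close>

lemma n_nondominated:
  assumes "n1 $ 2 \<ge> n $ 2" "n2 $ 1 \<ge> n $ 1"
  shows "n \<in> nondominated X z"
proof (unfold nondominated_iff, intro conjI ballI impI n_image)
  fix q assume q: "q \<in> objective z ` X" "q $ 1 \<le> n $ 1" "q $ 2 \<le> n $ 2"
  have below: "\<not> (q $ 1 < y $ 1 \<and> q $ 2 < y $ 2)"
    using no_image_below_y region_down_closed[OF n_in_region q] by blast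
  have "q $ 2 = n $ 2" if "q $ 1 = n $ 1"
    using below that q n_le_y assms n1_props(5)[OF _ q(1) that] by force
  moreover have "q $ 1 = n $ 1" if "q $ 2 = n $ 2"
    using below that q n_le_y assms n2_props(5)[OF _ q(1) that] by force
  ultimately show "q = n"
    using below q n_le_y by (intro vec2_eqI) force+
qed

lemma new_points_nondominated: "new_points \<subseteq> nondominated X z"
  using n1_nondominated n2_nondominated n_nondominated by (auto simp: new_points_def)

lemma new_points_in_region: "new_points \<subseteq> region X z b"
  using n1_in_region n2_in_region n_in_region by (auto simp: new_points_def)

lemma new_points_not_in_box1: "new_points \<inter> region X z box1 = {}"
  using n1_props(3) n2_props(2) by (auto simp: new_points_def region_def box1_def)

lemma new_points_not_in_box2: "new_points \<inter> region X z box2 = {}"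
  using n2_props(3) n1_props(2) by (auto simp: new_points_def region_def box2_def)

text \<open>Outside both new boxes, \<open>q\<close> is at least \<open>n1\<close> in the second and
  at least \<open>n2\<close> in the first coordinate. If at most one projection improved, this
  already puts the added point weakly below \<open>q\<close>.\<close>

lemma nondominated_cover:
  assumes q: "q \<in> nondominated X z" "q \<in> region X z b"
  shows "q \<in> new_points \<or> q \<in> region X z box1 \<or> q \<in> region X z box2"
proof (rule ccontr)
  assume not: "\<not> ?thesis"
  have ge: "n1 $ 2 \<le> q $ 2" "n2 $ 1 \<le> q $ 1"
    using not q(2) by (auto simp: region_def box1_def box2_def)
  have min: "r = q" if "r \<in> objective z ` X" "r $ 1 \<le> q $ 1" "r $ 2 \<le> q $ 2" for r
    using q(1) that by (auto simp: nondominated_iff)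
  have "q = n1 \<and> n1 $ 2 < n $ 2 \<or> q = n2 \<and> n2 $ 1 < n $ 1 \<or>
      q = n \<and> n1 $ 2 \<ge> n $ 2 \<and> n2 $ 1 \<ge> n $ 1"
  proof (cases "n1 $ 2 < n $ 2"; cases "n2 $ 1 < n $ 1")
    \<comment> \<open>Only here is a corner uncovered: the points strictly below \<open>n\<close> in
      both coordinates. Since \<open>y\<close> equals \<open>n\<close>, it contains no image of the
      region.\<close>
    assume lt: "n1 $ 2 < n $ 2" "n2 $ 1 < n $ 1"
    then have "y $ 1 = n $ 1" "y $ 2 = n $ 2" using n1_props(4) n2_props(4) by auto
    then have "n $ 1 \<le> q $ 1 \<or> n $ 2 \<le> q $ 2"
      using no_image_below_y[OF q(2)] by force
    then show ?thesis
      using min[OF n1_props(1)] min[OF n2_props(1)] ge lt n1_props(2) n2_props(2)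
      by auto
  qed (use min[OF n1_props(1)] min[OF n2_props(1)] min[OF n_image] ge
      n1_props(2,3) n2_props(2,3) in auto)
  then have "q \<in> new_points"
    unfolding new_points_def by auto
  with not show False by blast
qed

lemma finite_new_points: "finite new_points"
  by (simp add: new_points_def)

text \<open>Two points are added only if both projections improve, which forces
  \<open>y = n\<close>; so \<open>C\<^sub>2\<close> really counts sub-cases of
  \<open>C\<close>.\<close>

lemma card_new_points:
  "card new_points = 1 + of_bool (y = n \<and> n1 $ 2 < n $ 2 \<and> n2 $ 1 < n $ 1)"
proof -
  have "y = n" if "n1 $ 2 < n $ 2" "n2 $ 1 < n $ 1"
    using that n1_props(4) n2_props(4) by (intro vec2_eqI) auto
  moreover have "n1 \<noteq> n2" if "n2 $ 1 < n $ 1" using that n1_props(2) by auto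
  ultimately show ?thesis by (auto simp: new_points_def)
qed

text \<open>At least one projection is solved by \<open>touches\<close>, and both exactly if
  \<open>y = n\<close>. This is the source of the term \<open>C\<close>.\<close>

lemma card_projections:
  "of_bool (y $ 1 = n $ 1) + of_bool (y $ 2 = n $ 2) = (1 + of_bool (y = n) :: nat)"
  using touches by (auto intro: vec2_eqI)

text \<open>By integrality an image in the box is at least 1 beyond the lower left corner in each
  coordinate, and it is strictly inside the upper bounds; so both sides would exceed 1.\<close>

lemma eliminated_box1_empty:
  assumes "\<not> (box_p b $ 1 - n1 $ 1 > 1 \<and> n1 $ 2 - box_p b $ 2 > 1)"
  shows "region X z box1 = {}"
proof (rule ccontr)
  assume "region X z box1 \<noteq> {}"
  then obtain q where q: "q \<in> region X z box1" by blast
  have im: "q \<in> objective z ` X" "q $ 1 < box_p b $ 1" "q $ 2 < n1 $ 2"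
    using q by (auto simp: region_def box1_def)
  have p: "box_p b \<in> objective z ` X" using good by (simp add: good_box_def)
  show False
    using assms image_add_one_le[OF n1_props(1) im(1) region_box1_gt(1)[OF q]] im(2,3)
      image_add_one_le[OF p im(1) region_box1_gt(2)[OF q]] by linarith
qed

lemma eliminated_box2_empty:
  assumes "\<not> (n2 $ 1 - box_t b $ 1 > 1 \<and> box_t b $ 2 - n2 $ 2 > 1)"
  shows "region X z box2 = {}"
proof (rule ccontr)
  assume "region X z box2 \<noteq> {}"
  then obtain q where q: "q \<in> region X z box2" by blast
  have im: "q \<in> objective z ` X" "q $ 1 < n2 $ 1" "q $ 2 < box_t b $ 2"
    using q by (auto simp: region_def box2_def)
  have t: "box_t b \<in> objective z ` X" using good by (simp add: good_box_def)
  show False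
    using assms image_add_one_le[OF n2_props(1) im(1) region_box2_gt(1)[OF q]] im(2,3)
      image_add_one_le[OF t im(1) region_box2_gt(2)[OF q]] by linarith
qed

end

section \<open>Disjoint boxes, loop invariant and termination measure\<close>

definition separated :: "box \<Rightarrow> box \<Rightarrow> bool" where
  "separated b b' \<longleftrightarrow> box_p b $ 1 \<le> box_t b' $ 1 \<or> box_p b' $ 1 \<le> box_t b $ 1"

text \<open>First coordinates suffice: the images in a good box lie strictly between its
  \<open>t\<close> and \<open>p\<close> there, and a split divides this interval.\<close>

lemma separated_regions_disjoint:
  assumes "good_box X z b" "good_box X z b'" "separated b b'"
  shows "region X z b \<inter> region X z b' = {}"
proof -
  have "box_t b $ 1 < q $ 1" "q $ 1 < box_p b $ 1" if "q \<in> region X z b" for q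
    using that assms(1) by (auto simp: good_box_def region_def)
  moreover have "box_t b' $ 1 < q $ 1" "q $ 1 < box_p b' $ 1" if "q \<in> region X z b'" for q
    using that assms(2) by (auto simp: good_box_def region_def)
  ultimately show ?thesis
    using assms(3) unfolding separated_def by fastforce
qed

text \<open>
  Separation is what makes the boxes distinct, so that the set \<open>boxes\<close> counts like a multiset.
\<close>

definition invariant :: "(int ^ 'n) set \<Rightarrow> (int ^ 'n \<Rightarrow> int ^ 2) \<Rightarrow> alg_state \<Rightarrow> bool" where
  "invariant X z \<sigma> \<longleftrightarrow>
     finite (boxes \<sigma>) \<and> (\<forall>b\<in>boxes \<sigma>. good_box X z b) \<and>
     (\<forall>b\<in>boxes \<sigma>. \<forall>b'\<in>boxes \<sigma>. b \<noteq> b' \<longrightarrow> separated b b') \<and>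
     found \<sigma> \<subseteq> nondominated X z \<and> 2 \<le> card (found \<sigma>) \<and>
     (\<forall>y\<in>nondominated X z. y \<notin> found \<sigma> \<longleftrightarrow> (\<exists>b\<in>boxes \<sigma>. y \<in> region X z b)) \<and>
     int (programs \<sigma>) + int (card (boxes \<sigma>)) =
       3 * int (card (found \<sigma>)) + int (cases_eq \<sigma>) - 3 * int (cases_two \<sigma>)
         - int (eliminated \<sigma>) - 1"

text \<open>An infeasible step removes a box. A feasible one discovers a point, which lowers the
  first summand by at least 3, and has a net gain of at most one box.\<close>

definition progress :: "(int ^ 'n) set \<Rightarrow> (int ^ 'n \<Rightarrow> int ^ 2) \<Rightarrow> alg_state \<Rightarrow> nat" where
  "progress X z \<sigma> = 3 * (card (nondominated X z) - card (found \<sigma>)) + card (boxes \<sigma>)"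

section \<open>The initial state and infeasible iterations\<close>

context biobjective
begin

lemma invariant_initial:
  assumes "initial X z \<sigma>"
  shows "invariant X z \<sigma>"
proof -
  obtain xt xp t p where xt: "lexmin X z 1 2 xt" "t = objective z xt"
    and xp: "lexmin X z 2 1 xp" "p = objective z xp"
    and \<sigma>: "\<sigma> = \<lparr>boxes = {Box (vector [t $ 1, p $ 2]) p t}, found = {t, p},
             programs = 4, cases_eq = 0, cases_two = 0, eliminated = 0\<rparr>"
    using assms unfolding initial_def by blast
  have nd: "t \<in> nondominated X z" "p \<in> nondominated X z"
    using lexmin_nondominated xt xp by auto
  have t: "t \<in> objective z ` X" "\<And>q. q \<in> objective z ` X \<Longrightarrow> t $ 1 \<le> q $ 1"
    "\<And>q. q \<in> objective z ` X \<Longrightarrow> q $ 1 = t $ 1 \<Longrightarrow> t $ 2 \<le> q $ 2"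
    using lexmin_imageD[OF xt(1)] xt(2) by auto
  have p: "p \<in> objective z ` X" "\<And>q. q \<in> objective z ` X \<Longrightarrow> p $ 2 \<le> q $ 2"
    "\<And>q. q \<in> objective z ` X \<Longrightarrow> q $ 2 = p $ 2 \<Longrightarrow> p $ 1 \<le> q $ 1"
    using lexmin_imageD[OF xp(1)] xp(2) by auto
  have min: "r = q" if "q \<in> nondominated X z" "r \<in> objective z ` X" "r $ 1 \<le> q $ 1" "r $ 2 \<le> q $ 2"
    for q r using that by (auto simp: nondominated_iff)
  have im: "q \<in> objective z ` X" if "q \<in> nondominated X z" for q
    using that by (simp add: nondominated_iff)
  \<comment> \<open>If the two optima coincided, this point would be below every image and hence the
    only nondominated one.\<close>
  have "t \<noteq> p"
  proof
    assume "t = p"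
    have "q = t" if "q \<in> nondominated X z" for q
      using min[OF that t(1)] t(2)[OF im[OF that]] p(2)[OF im[OF that]] \<open>t = p\<close> by simp
    with nd(1) have "nondominated X z = {t}" by blast
    then show False using card_ne_one by simp
  qed
  have "t = p" if "t $ 1 = p $ 1"
    using that t(3)[OF p(1)] p(2)[OF t(1)] by (intro vec2_eqI) linarith+
  with \<open>t \<noteq> p\<close> have "t $ 1 \<noteq> p $ 1" by blast
  then have "t $ 1 < p $ 1" using t(2)[OF p(1)] by linarith
  let ?b = "Box (vector [t $ 1, p $ 2]) p t"
  have "t $ 1 < q $ 1 \<and> p $ 2 < q $ 2" if "q \<in> region X z ?b" for q
  proof -
    have q: "q \<in> objective z ` X" "q $ 1 < p $ 1" "q $ 2 < t $ 2"
      using that by (auto simp: region_def)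
    have "q $ 1 \<noteq> t $ 1" "q $ 2 \<noteq> p $ 2"
      using t(3)[OF q(1)] p(3)[OF q(1)] q(2,3) by linarith+
    then show ?thesis using t(2)[OF q(1)] p(2)[OF q(1)] by linarith
  qed
  then have good: "good_box X z ?b"
    using t(1) p(1) \<open>t $ 1 < p $ 1\<close> by (simp add: good_box_def)
  have cover: "q \<notin> {t, p} \<longleftrightarrow> q \<in> region X z ?b" if "q \<in> nondominated X z" for q
  proof
    assume "q \<notin> {t, p}"
    then have "\<not> p $ 1 \<le> q $ 1" "\<not> t $ 2 \<le> q $ 2"
      using min[OF that p(1)] min[OF that t(1)] p(2)[OF im[OF that]] t(2)[OF im[OF that]] by auto
    then show "q \<in> region X z ?b" using im[OF that] by (auto simp: region_def)
  qed (auto simp: region_def)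
  show ?thesis
    unfolding invariant_def
  proof (intro conjI ballI)
    fix q assume "q \<in> nondominated X z"
    from cover[OF this] show "q \<notin> found \<sigma> \<longleftrightarrow> (\<exists>b\<in>boxes \<sigma>. q \<in> region X z b)"
      by (simp add: \<sigma>)
  \<comment> \<open>The count starts as 4 + 1 = 3 * 2 - 1, two points being found because
    \<open>t\<close> and \<open>p\<close> differ.\<close>
  qed (use good nd \<open>t \<noteq> p\<close> in \<open>simp_all add: \<sigma>\<close>)
qed

text \<open>A nondominated point below an image of the region is in the region too, hence not yet
  found. Together with the two or more found points it makes at least three.\<close>

lemma region_nonempty_imp_direction_pos:
  assumes inv: "invariant X z \<sigma>" and b: "b \<in> boxes \<sigma>" "region X z b \<noteq> {}"
  shows "0 < d $ 1 \<and> 0 < d $ 2"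
proof -
  obtain q where q: "q \<in> region X z b" using b by blast
  then obtain r where r: "r \<in> nondominated X z" "r $ 1 \<le> q $ 1" "r $ 2 \<le> q $ 2"
    using ex_nondominated_le[of q] by (auto simp: region_def)
  then have "r \<in> region X z b"
    using q by (auto simp: region_def nondominated_iff)
  then have "r \<notin> found \<sigma>" using inv b r by (auto simp: invariant_def)
  then have "found \<sigma> \<subset> nondominated X z" using inv r by (auto simp: invariant_def)
  then have "card (found \<sigma>) < card (nondominated X z)"
    by (rule psubset_card_mono[OF finite_nondominated])
  moreover have "2 \<le> card (found \<sigma>)" using inv by (simp add: invariant_def)
  ultimately show ?thesis using direction_pos by linarith
qed

lemma infeasible_step:
  assumes inv: "invariant X z \<sigma>" and b: "b \<in> boxes \<sigma>" and inf: "R_feasible X z \<epsilon> d b = {}"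
    and \<sigma>': "\<sigma>' = \<sigma>\<lparr>boxes := boxes \<sigma> - {b}, programs := programs \<sigma> + 1\<rparr>"
  shows "invariant X z \<sigma>' \<and> progress X z \<sigma>' < progress X z \<sigma>"
proof -
  \<comment> \<open>Infeasibility loses no point: a nonempty region would make \<open>d\<close>
    positive, and then an optimal solution would exist.\<close>
  have "region X z b = {}"
  proof (rule ccontr)
    assume "region X z b \<noteq> {}"
    then obtain \<alpha> x where "R_optimal X z \<epsilon> d b \<alpha> x"
      using ex_R_optimal[of b] region_nonempty_imp_direction_pos[OF inv b] inv b
      by (auto simp: invariant_def)
    with inf show False by (simp add: R_optimal_def is_arg_min_def)
  qed
  \<comment> \<open>One more program and one box fewer leave the counting equation
    unchanged.\<close>
  moreover have "card (boxes \<sigma>) = Suc (card (boxes \<sigma> - {b}))"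
    using inv b by (metis card_Suc_Diff1 invariant_def)
  ultimately show ?thesis
    using inv unfolding invariant_def progress_def \<sigma>' by auto
qed

end

section \<open>Feasible iterations\<close>

context box_split
begin

lemma feasible_step:
  fixes \<sigma> \<sigma>' :: alg_state and nb :: "box set"
  assumes inv: "invariant X z \<sigma>" and b: "b \<in> boxes \<sigma>"
    and keep1: "keep1 \<longleftrightarrow> box_p b $ 1 - n1 $ 1 > 1 \<and> n1 $ 2 - box_p b $ 2 > 1"
    and keep2: "keep2 \<longleftrightarrow> n2 $ 1 - box_t b $ 1 > 1 \<and> box_t b $ 2 - n2 $ 2 > 1"
    and nb: "nb = (if keep1 then {box1} else {}) \<union> (if keep2 then {box2} else {})"
    and \<sigma>': "\<sigma>' = \<lparr>boxes = (boxes \<sigma> \<union> nb) - {b},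
           found = found \<sigma> \<union> new_points,
           programs = programs \<sigma> + 1 + of_bool (y $ 1 = n $ 1) + of_bool (y $ 2 = n $ 2),
           cases_eq = cases_eq \<sigma> + of_bool (y = n),
           cases_two = cases_two \<sigma> + of_bool (y = n \<and> n1 $ 2 < n $ 2 \<and> n2 $ 1 < n $ 1),
           eliminated = eliminated \<sigma> + of_bool (\<not> keep1) + of_bool (\<not> keep2)\<rparr>"
  shows "invariant X z \<sigma>' \<and> progress X z \<sigma>' < progress X z \<sigma>"
proof -
  have fin: "finite (boxes \<sigma>)" and all_good: "\<forall>c\<in>boxes \<sigma>. good_box X z c"
    and all_sep: "\<forall>c\<in>boxes \<sigma>. \<forall>c'\<in>boxes \<sigma>. c \<noteq> c' \<longrightarrow> separated c c'"
    and found: "found \<sigma> \<subseteq> nondominated X z" "2 \<le> card (found \<sigma>)"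
    and all_cover: "\<forall>q\<in>nondominated X z. q \<notin> found \<sigma> \<longleftrightarrow> (\<exists>c\<in>boxes \<sigma>. q \<in> region X z c)"
    and count: "int (programs \<sigma>) + int (card (boxes \<sigma>)) =
       3 * int (card (found \<sigma>)) + int (cases_eq \<sigma>) - 3 * int (cases_two \<sigma>)
         - int (eliminated \<sigma>) - 1"
    by (insert inv, unfold invariant_def) (elim conjE, assumption)+
  note goods = bspec[OF all_good] and cover = bspec[OF all_cover]
  have sep: "separated c c'" if "c \<in> boxes \<sigma>" "c' \<in> boxes \<sigma>" "c \<noteq> c'" for c c'
    using all_sep that by blast
  have fin_nb: "finite nb" by (simp add: nb)
  have nb_good: "good_box X z c" if "c \<in> nb" for c
    using that good_box1 good_box2 by (auto simp: nb split: if_splits)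
  have box12: "separated box1 box2" "separated box2 box1" "box1 \<noteq> box2"
    using n1_props(2) n2_props(3) n_bounds by (auto simp: separated_def box1_def box2_def)
  have shrink: "separated c b \<Longrightarrow> separated c c'" "separated c b \<Longrightarrow> separated c' c"
    if "c' \<in> nb" for c c'
    using that n1_props(2) n2_props(3) n_bounds
    by (auto simp: nb separated_def box1_def box2_def split: if_splits)
  have irrefl: "\<not> separated c c" if "good_box X z c" for c
    using that by (auto simp: separated_def good_box_def)
  \<comment> \<open>The iteration removes \<open>b\<close> after inserting the new boxes, so neither
    of them may coincide with it.\<close>
  have "box_t box1 \<noteq> box_t b" "box_p box2 \<noteq> box_p b"
    using n1_props(3) n2_props(3) n_bounds by (force simp: box1_def box2_def)+
  then have b_notin: "b \<notin> nb"
    by (auto simp: nb split: if_splits)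
  \<comment> \<open>A new box that was already present would be separated from \<open>b\<close>,
    hence by \<open>shrink\<close> from itself.\<close>
  have disj: "boxes \<sigma> \<inter> nb = {}"
  proof (rule ccontr)
    assume "boxes \<sigma> \<inter> nb \<noteq> {}"
    then obtain c where c: "c \<in> boxes \<sigma>" "c \<in> nb" by blast
    then have "separated c b" using sep[OF c(1) b] b_notin by blast
    then show False using shrink(1)[OF c(2)] irrefl[OF goods[OF c(1)]] by blast
  qed
  have boxes': "boxes \<sigma>' = (boxes \<sigma> - {b}) \<union> nb" using b_notin by (auto simp: \<sigma>')
  have card_nb: "card nb + of_bool (\<not> keep1) + of_bool (\<not> keep2) = 2"
    using box12(3) by (auto simp: nb)
  have card_boxes: "card (boxes \<sigma>') + 1 = card (boxes \<sigma>) + card nb"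
  proof -
    have "card (boxes \<sigma>') = card (boxes \<sigma> - {b}) + card nb"
      unfolding boxes' using fin fin_nb disj by (intro card_Un_disjoint) auto
    moreover have "card (boxes \<sigma>) = Suc (card (boxes \<sigma> - {b}))"
      using fin b by (metis card_Suc_Diff1)
    ultimately show ?thesis by simp
  qed
  have new_not_found: "found \<sigma> \<inter> new_points = {}"
    using cover new_points_nondominated new_points_in_region b by blast
  have fin_found: "finite (found \<sigma>)" using found finite_nondominated finite_subset by blast
  have card_found: "card (found \<sigma>') = card (found \<sigma>) + card new_points"
    using card_Un_disjoint[OF fin_found finite_new_points new_not_found] by (simp add: \<sigma>')
  have found': "found \<sigma>' \<subseteq> nondominated X z"
    using found new_points_nondominated by (auto simp: \<sigma>')
  have nb_region: "region X z c \<subseteq> region X z b" "new_points \<inter> region X z c = {}"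
    if "c \<in> nb" for c
    using that region_box1_subset region_box2_subset new_points_not_in_box1 new_points_not_in_box2
    by (auto simp: nb split: if_splits)
  have other: "region X z b \<inter> region X z c = {}" if "c \<in> boxes \<sigma> - {b}" for c
    using that sep[OF b, of c] separated_regions_disjoint[OF good goods] by blast
  have kept: "q \<in> region X z box1 \<or> q \<in> region X z box2 \<longleftrightarrow> (\<exists>c\<in>nb. q \<in> region X z c)" for q
    using eliminated_box1_empty eliminated_box2_empty by (auto simp: nb keep1 keep2)
  have cover': "q \<notin> found \<sigma>' \<longleftrightarrow> (\<exists>c\<in>boxes \<sigma>'. q \<in> region X z c)"
    if q: "q \<in> nondominated X z" for q
  proof -
    have "found \<sigma>' = found \<sigma> \<union> new_points" by (simp add: \<sigma>')
    then show ?thesis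
      unfolding boxes' using cover[OF q] nondominated_cover[OF q] kept[of q] nb_region other
        new_points_in_region b by blast
  qed
  have sep': "separated c c'" if "c \<in> boxes \<sigma>'" "c' \<in> boxes \<sigma>'" "c \<noteq> c'" for c c'
  proof (cases "c \<in> nb"; cases "c' \<in> nb")
    assume "c \<in> nb" "c' \<in> nb"
    then show ?thesis using \<open>c \<noteq> c'\<close> box12 by (auto simp: nb split: if_splits)
  qed (use that sep[OF _ b] sep shrink in \<open>auto simp: boxes'\<close>)
  have "invariant X z \<sigma>'"
    unfolding invariant_def
  proof (intro conjI ballI impI)
    \<comment> \<open>With e boxes eliminated, the programs grow by 2 + [y = n] and the boxes by 1 -
      e. The right side grows by the same 3 + [y = n] - e, the second point found being cancelled by
      \<open>cases_two\<close>.\<close>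
    show "int (programs \<sigma>') + int (card (boxes \<sigma>')) =
       3 * int (card (found \<sigma>')) + int (cases_eq \<sigma>') - 3 * int (cases_two \<sigma>')
         - int (eliminated \<sigma>') - 1"
    proof -
      have "programs \<sigma>' = programs \<sigma> + 2 + of_bool (y = n)"
        using card_projections by (simp add: \<sigma>')
      moreover have "eliminated \<sigma>' + card nb = eliminated \<sigma> + 2"
        using card_nb by (simp add: \<sigma>')
      moreover have "cases_eq \<sigma>' = cases_eq \<sigma> + of_bool (y = n)" by (simp add: \<sigma>')
      moreover have "cases_two \<sigma>' + 1 = cases_two \<sigma> + card new_points"
        unfolding card_new_points by (simp add: \<sigma>')
      ultimately show ?thesis using count card_found card_boxes by linarith
    qed
  qed (use fin fin_nb goods nb_good sep' found' found(2) card_found cover' in \<open>auto simp: boxes'\<close>)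
  moreover have "progress X z \<sigma>' < progress X z \<sigma>"
  proof -
    have "card (found \<sigma>') \<le> card (nondominated X z)"
      using card_mono[OF finite_nondominated found'] .
    moreover have "card new_points \<ge> 1" by (simp add: card_new_points)
    ultimately show ?thesis
      unfolding progress_def using card_found card_boxes card_nb by linarith
  qed
  ultimately show ?thesis by blast
qed

end

section \<open>Runs of the algorithm\<close>

context biobjective
begin

lemma step_invariant_progress:
  assumes "step X z \<epsilon> d \<sigma> \<sigma>'" and inv: "invariant X z \<sigma>"
  shows "invariant X z \<sigma>' \<and> progress X z \<sigma>' < progress X z \<sigma>"
  using assms(1)
proof cases
  case (infeasible b)
  with inv show ?thesis by (intro infeasible_step)
next
  case split: (feasible b s p t \<alpha> x y n n1 n2 np s1 s2 keep1 keep2 new_boxes)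
  have "good_box X z b" using inv split by (simp add: invariant_def)
  moreover have "region X z b \<noteq> {}"
    using split R_feasible_imp_region[of \<alpha> x b] by (auto simp: R_optimal_def is_arg_min_def)
  then have "0 < d $ 1 \<and> 0 < d $ 2"
    using region_nonempty_imp_direction_pos[OF inv] split by blast
  ultimately interpret box_split X z d \<epsilon> b \<alpha> x y n n1 n2
    using split by unfold_locales simp_all
  have np: "np = new_points"
    unfolding new_points_def by (rule split)
  show ?thesis
  proof (rule feasible_step[OF inv])
    show "b \<in> boxes \<sigma>" by (rule split)
    show "keep1 \<longleftrightarrow> box_p b $ 1 - n1 $ 1 > 1 \<and> n1 $ 2 - box_p b $ 2 > 1"
      using split(3,10,12) by (simp add: vector_2)
    show "keep2 \<longleftrightarrow> n2 $ 1 - box_t b $ 1 > 1 \<and> box_t b $ 2 - n2 $ 2 > 1"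
      using split(3,11,13) by (simp add: vector_2)
    show "new_boxes = (if keep1 then {box1} else {}) \<union> (if keep2 then {box2} else {})"
      unfolding box1_def box2_def using split(3,10,11,14) by simp
  qed (use split(1) np in simp)
qed

text \<open>This shows that a run can stop only when no box is left: every subproblem that is
  feasible has an optimal solution, and so do the projections.\<close>

lemma ex_step:
  assumes inv: "invariant X z \<sigma>" and b: "b \<in> boxes \<sigma>"
  shows "\<exists>\<sigma>'. step X z \<epsilon> d \<sigma> \<sigma>'"
proof (cases "R_feasible X z \<epsilon> d b = {}")
  case True
  with b show ?thesis by (blast intro: step.infeasible)
next
  case False
  then have ne: "region X z b \<noteq> {}" using R_feasible_imp_region by fastforce
  have "good_box X z b" using inv b by (simp add: invariant_def)
  then obtain \<alpha> x where opt: "R_optimal X z \<epsilon> d b \<alpha> x"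
    using ex_R_optimal ne region_nonempty_imp_direction_pos[OF inv b ne] by blast
  then have x: "x \<in> X" by (auto simp: R_optimal_def is_arg_min_def R_feasible_def)
  obtain s p t where bs: "b = Box s p t" by (cases b)
  let ?n = "objective z x" and ?y = "s + \<alpha> *\<^sub>R d"
  have "\<exists>n1. if ?y $ 1 = ?n $ 1 then \<exists>x1. P1_optimal X z x x1 \<and> n1 = objective z x1 else n1 = ?n"
    using ex_P1_optimal[OF x] by auto
  moreover
  have "\<exists>n2. if ?y $ 2 = ?n $ 2 then \<exists>x2. P2_optimal X z x x2 \<and> n2 = objective z x2 else n2 = ?n"
    using ex_P2_optimal[OF x] by auto
  ultimately show ?thesis
    using step.feasible[OF b bs opt refl refl _ _ refl refl refl refl refl refl] by blast
qed

lemma invariant_rtranclp: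
  assumes "(step X z \<epsilon> d)\<^sup>*\<^sup>* \<sigma>0 \<sigma>" "invariant X z \<sigma>0"
  shows "invariant X z \<sigma>"
  using assms by induction (use step_invariant_progress in blast)+

lemma no_infinite_run:
  assumes "initial X z (run 0)" and step: "\<And>k::nat. step X z \<epsilon> d (run k) (run (Suc k))"
  shows False
proof -
  have inv: "invariant X z (run k)" for k
    by (induction k) (use invariant_initial assms step_invariant_progress in blast)+
  have "(run (Suc k), run k) \<in> inv_image less_than (progress X z)" for k
    using step_invariant_progress[OF step inv] by simp
  then show False
    using wf_inv_image[OF wf_less_than, of "progress X z"] unfolding wf_iff_no_infinite_down_chain by blast
qed

end

theorem proposition3p3:
  fixes X :: "(int ^ 'n) set" and z :: "int ^ 'n \<Rightarrow> int ^ 2" and d :: "real ^ 2" and \<epsilon> :: real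
  assumes nonempty: "X \<noteq> {}"
    and lexmin12: "\<exists>x. lexmin X z 1 2 x"
    and lexmin21: "\<exists>x. lexmin X z 2 1 x"
    and d_nonneg: "0 \<le> d" and d_nonzero: "d \<noteq> 0"
    and eps: "0 < \<epsilon>" "\<epsilon> < 1"
    and not_ideal: "card (nondominated X z) \<noteq> 1"
    and d_pos: "card (nondominated X z) > 2 \<Longrightarrow> 0 < d $ 1 \<and> 0 < d $ 2"
  shows "finite (nondominated X z) \<and>
    (\<nexists>run. initial X z (run 0) \<and> (\<forall>k::nat. step X z \<epsilon> d (run k) (run (Suc k)))) \<and>
    (\<forall>\<sigma>0 \<sigma>. initial X z \<sigma>0 \<and> (step X z \<epsilon> d)\<^sup>*\<^sup>* \<sigma>0 \<sigma> \<and> (\<nexists>\<sigma>'. step X z \<epsilon> d \<sigma> \<sigma>') \<longrightarrow>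
       boxes \<sigma> = {} \<and>
       int (programs \<sigma>) =
         3 * int (card (nondominated X z)) + int (cases_eq \<sigma>) - 3 * int (cases_two \<sigma>)
           - int (eliminated \<sigma>) - 1)"
proof -
  interpret biobjective X z d \<epsilon>
    using assms by unfold_locales
  have "boxes \<sigma> = {} \<and> int (programs \<sigma>) =
         3 * int (card (nondominated X z)) + int (cases_eq \<sigma>) - 3 * int (cases_two \<sigma>)
           - int (eliminated \<sigma>) - 1"
    if "initial X z \<sigma>0" "(step X z \<epsilon> d)\<^sup>*\<^sup>* \<sigma>0 \<sigma>" "\<nexists>\<sigma>'. step X z \<epsilon> d \<sigma> \<sigma>'" for \<sigma>0 \<sigma>
  proof -
    have inv: "invariant X z \<sigma>"
      using invariant_rtranclp[OF that(2)] invariant_initial[OF that(1)] .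
    have "boxes \<sigma> = {}" using ex_step[OF inv] that(3) by blast
    \<comment> \<open>Without boxes, the covering clause of the invariant leaves no nondominated
      point undiscovered, so the counting equation becomes the claim.\<close>
    moreover from this have "found \<sigma> = nondominated X z"
      using inv by (auto simp: invariant_def)
    ultimately show ?thesis using inv by (simp add: invariant_def)
  qed
  with finite_nondominated no_infinite_run show ?thesis by blast
qed

end
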